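(* Let $F_h \ge 1$ be an integer, let $\bm{\mu}_0,\bm{\mu}_1\in\mathbb{R}^{F_h}$, and let $\sigma_0,\sigma_1>0$ with $\sigma_0^2\neq\sigma_1^2$. Let $z\in\{0,1\}$ be a random label with prior $\mathbb{P}(z=0)=\mathbb{P}(z=1)=1/2$, and let $\bm{x}\in\mathbb{R}^{F_h}$ be a random vector such that, conditionally on $z=0$, $\bm{x}\sim N(\bm{\mu}_0,\sigma_0^2 I)$ and, conditionally on $z=1$, $\bm{x}\sim N(\bm{\mu}_1,\sigma_1^2 I)$. Then the optimal Bayes classifier for predicting $z$ from $\bm{x}$ is $$\mathrm{CL}_{\mathrm{Bayes}}(\bm{x})=\begin{cases}1, & \eta(\bm{x})\ge 0.5,\\ 0, & \eta(\bm{x})<0.5,\end{cases}\qquad \eta(\bm{x})=\mathbb{P}(z=1\mid\bm{x})=\frac{1}{1+\exp(Q(\bm{x}))},$$ where $Q(\bm{x})=a\,\bm{x}^\top\bm{x}+\bm{b}^\top\bm{x}+c$ with $$a=\frac12\left(\frac{1}{\sigma_1^2}-\frac{1}{\sigma_0^2}\right),\qquad \bm{b}=\frac{\bm{\mu}_0}{\sigma_0^2}-\frac{\bm{\mu}_1}{\sigma_1^2},\qquad c=\frac{\bm{\mu}_1^\top\bm{\mu}_1}{2\sigma_1^2}-\frac{\bm{\mu}_0^\top\bm{\mu}_0}{2\sigma_0^2}+\ln\left(\frac{\sigma_1^{F_h}}{\sigma_0^{F_h}}\right).$$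
   Context: The setting is the node-feature distribution of the Contextual Stochastic Block Model for Homophily, CSBM-H$(\bm{\mu}_0,\bm{\mu}_1,\sigma_0^2 I,\sigma_1^2 I,d_0,d_1,h)$: there are two disjoint classes of nodes $\mathcal{C}_0$ and $\mathcal{C}_1$, and each node's feature vector is generated independently, from $N(\bm{\mu}_0,\sigma_0^2 I)$ for nodes in $\mathcal{C}_0$ (label $z=0$) and from $N(\bm{\mu}_1,\sigma_1^2 I)$ for nodes in $\mathcal{C}_1$ (label $z=1$). The degree parameters $d_0,d_1$ and the homophily parameter $h$ do not affect the distribution of the original features $\bm{x}$, which are the ones considered here. The event "$\bm{x}\in\mathcal{C}_k$" means that the node with feature $\bm{x}$ has label $k$. The optimal Bayes classifier is the classifier that minimizes the misclassification probability $\mathbb{P}(\mathrm{CL}(\bm{x})\neq z)$ among measurable maps $\mathrm{CL}:\mathbb{R}^{F_h}\to\{0,1\}$, i.e. the one that predicts a label of largest posterior probability given $\bm{x}$, with ties resolved in favour of label $1$. *)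

theory Defs
  imports "HOL-Probability.Probability"
begin

text \<open>Lebesgue density of \<open>N(m, S)\<close>; meaningful for positive definite \<open>S\<close>.\<close>

definition mvnormal_density :: "real ^ 'n \<Rightarrow> real ^ 'n ^ 'n \<Rightarrow> real ^ 'n \<Rightarrow> real" where
  "mvnormal_density m S v =
     exp (- ((v - m) \<bullet> (matrix_inv S *v (v - m))) / 2) / sqrt ((2 * pi) ^ CARD('n) * det S)"

text \<open>A version of \<open>P(Z = k | X)\<close>, the conditional probability given the \<open>\<sigma>\<close>-algebra generated
  by \<open>X\<close>. It is a function on the sample space, determined up to null sets.\<close>

definition posterior ::
  "'a measure \<Rightarrow> ('a \<Rightarrow> 'b::topological_space) \<Rightarrow> ('a \<Rightarrow> nat) \<Rightarrow> nat \<Rightarrow> 'a \<Rightarrow> real" where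
  "posterior M X Z k =
     real_cond_exp M (vimage_algebra (space M) X borel) (indicator {\<omega> \<in> space M. Z \<omega> = k})"

definition misclass_prob ::
  "'a measure \<Rightarrow> ('a \<Rightarrow> 'b) \<Rightarrow> ('a \<Rightarrow> nat) \<Rightarrow> ('b \<Rightarrow> nat) \<Rightarrow> real" where
  "misclass_prob M X Z CL = measure M {\<omega> \<in> space M. CL (X \<omega>) \<noteq> Z \<omega>}"

text \<open>The last conjunct says that \<open>CL\<close> predicts a label of largest posterior probability and
  resolves ties in favour of label 1.\<close>

definition bayes_classifier ::
  "'a measure \<Rightarrow> ('a \<Rightarrow> 'b::topological_space) \<Rightarrow> ('a \<Rightarrow> nat) \<Rightarrow> ('b \<Rightarrow> nat) \<Rightarrow> bool" where
  "bayes_classifier M X Z CL \<longleftrightarrow>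
     CL \<in> borel \<rightarrow>\<^sub>M count_space {0, 1} \<and>
     (\<forall>CL' \<in> borel \<rightarrow>\<^sub>M count_space {0, 1}. misclass_prob M X Z CL \<le> misclass_prob M X Z CL') \<and>
     (AE \<omega> in M. CL (X \<omega>) = (if posterior M X Z 1 \<omega> \<ge> posterior M X Z 0 \<omega> then 1 else 0))"

end

theory Submission
  imports Defs
begin

text \<open>The posterior probability of a class is the ratio of its weighted density to the sum of the
  weighted densities, and for two isotropic Gaussians with equal weights the quotient of the
  densities is \<open>exp \<circ> Q\<close>. Integrating against the posterior shows that a classifier \<open>CL\<close> errs with
  probability \<open>E (if CL X = 0 then \<eta> X else 1 - \<eta> X)\<close>, which is minimised pointwise by predicting
  1 exactly where \<open>\<eta> \<ge> 1/2\<close>.\<close>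

section \<open>Conditioning on an event and on the \<sigma>-algebra generated by
  \<open>X\<close>\<close>

lemma integral_uniform_measure:
  fixes f :: "'a \<Rightarrow> real"
  assumes "finite_measure M" and [measurable]: "f \<in> borel_measurable M" "S \<in> sets M"
    and "measure M S > 0"
  shows "(\<integral>x. f x \<partial>uniform_measure M S) = (\<integral>x. f x * indicator S x \<partial>M) / measure M S"
proof -
  interpret finite_measure M by fact
  have "uniform_measure M S = density M (\<lambda>x. ennreal (indicator S x / measure M S))"
    unfolding uniform_measure_def using assms(4)
    by (intro density_cong)
       (auto simp: emeasure_eq_measure indicator_def divide_ennreal simp flip: ennreal_1)
  then have "(\<integral>x. f x \<partial>uniform_measure M S) = (\<integral>x. indicator S x / measure M S * f x \<partial>M)"
    by (simp add: integral_real_density)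
  also have "\<dots> = (\<integral>x. (f x * indicator S x) / measure M S \<partial>M)"
    by (simp add: mult.commute)
  finally show ?thesis by simp
qed

text \<open>Gives access to the theory of \<open>real_cond_exp\<close> for the \<sigma>-algebra used
  in \<open>posterior\<close>: measurability of \<open>X\<close> makes it a subalgebra, and
  \<open>M\<close> is finite.\<close>

lemma finite_measure_subalgebra_vimage:
  assumes "prob_space M" and X: "X \<in> borel_measurable M"
  shows "finite_measure_subalgebra M (vimage_algebra (space M) X borel)"
proof -
  interpret prob_space M by fact
  show ?thesis
    by unfold_locales (auto simp: subalgebra_def dest: subsetD[OF sets_image_in_sets[OF refl X]])
qed

lemma measurable_vimage_algebra_comp:
  assumes "g \<in> borel \<rightarrow>\<^sub>M N"
  shows "(\<lambda>\<omega>. g (X \<omega>)) \<in> vimage_algebra S X borel \<rightarrow>\<^sub>M N"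
  using measurable_compose[OF measurable_vimage_algebra1 assms, of X S] by simp

lemma sets_label:
  assumes "Z \<in> M \<rightarrow>\<^sub>M count_space {0, 1}"
  shows "{\<omega> \<in> space M. Z \<omega> = k} \<in> sets M"
proof (cases "k \<in> {0, 1}")
  case True
  then have "Z -` {k} \<inter> space M \<in> sets M"
    by (intro measurable_sets[OF assms]) auto
  then show ?thesis
    by (simp add: vimage_def Int_def conj_commute)
next
  case False
  then have "{\<omega> \<in> space M. Z \<omega> = k} = {}"
    using measurable_space[OF assms] by auto
  then show ?thesis
    by (simp only: sets.empty_sets)
qed

section \<open>From class-conditional densities to the posterior\<close>

text \<open>Transports integrals over the event \<open>E\<close> to integrals against the density of
  \<open>X\<close> given \<open>E\<close>: the law of \<open>X\<close> under the conditioned measure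
  is substituted, and the normalisation by \<open>measure M E\<close> is undone.\<close>

lemma integral_class_density:
  fixes g :: "'b::topological_space \<Rightarrow> real"
  assumes "prob_space M" and E [measurable]: "E \<in> sets M" and "measure M E > 0"
    and X [measurable]: "X \<in> borel_measurable M" and N: "sets N = sets borel"
    and D: "distributed (uniform_measure M E) N X (\<lambda>v. ennreal (f v))"
    and f: "\<And>v. f v \<ge> 0" and g [measurable]: "g \<in> borel_measurable borel"
  shows "(\<integral>\<omega>. g (X \<omega>) * indicator E \<omega> \<partial>M) = measure M E * (\<integral>v. f v * g v \<partial>N)"
proof -
  interpret prob_space M by fact
  have "(\<integral>v. f v * g v \<partial>N) = (\<integral>\<omega>. g (X \<omega>) \<partial>uniform_measure M E)"
    using D f g N by (intro distributed_integral) (simp_all cong: measurable_cong_sets)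
  also have "\<dots> = (\<integral>\<omega>. g (X \<omega>) * indicator E \<omega> \<partial>M) / measure M E"
    using assms(3) by (intro integral_uniform_measure) (simp_all add: finite_measure_axioms)
  finally show ?thesis using assms(3) by simp
qed

text \<open>A bounded \<open>g\<close> is integrable under the probability measure conditioned on
  \<open>E\<close>, and this carries over to \<open>N\<close>. It justifies adding the contributions
  of the two classes under one integral.\<close>

lemma integrable_class_density:
  fixes g :: "'b::topological_space \<Rightarrow> real"
  assumes "prob_space M" and E [measurable]: "E \<in> sets M" and "measure M E > 0"
    and X [measurable]: "X \<in> borel_measurable M" and N: "sets N = sets borel"
    and D: "distributed (uniform_measure M E) N X (\<lambda>v. ennreal (f v))"
    and f: "\<And>v. f v \<ge> 0" and g [measurable]: "g \<in> borel_measurable borel"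
    and g_bound: "\<And>v. \<bar>g v\<bar> \<le> K"
  shows "integrable N (\<lambda>v. f v * g v)"
proof -
  interpret prob_space M by fact
  interpret U: prob_space "uniform_measure M E"
    using assms(3) by (intro prob_space_uniform_measure) (auto simp: emeasure_eq_measure)
  have "integrable (uniform_measure M E) (\<lambda>\<omega>. g (X \<omega>))"
    using g_bound by (intro U.integrable_const_bound[where B=K]) auto
  then show ?thesis
    using D f g N by (subst distributed_integrable) (simp_all cong: measurable_cong_sets)
qed

lemma posterior_eq_density_ratio:
  fixes X :: "'a \<Rightarrow> 'b::topological_space" and f0 f1 \<eta> :: "'b \<Rightarrow> real"
  assumes M: "prob_space M"
    and X [measurable]: "X \<in> borel_measurable M" and Z: "Z \<in> M \<rightarrow>\<^sub>M count_space {0, 1}"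
    and p0: "measure M {\<omega> \<in> space M. Z \<omega> = 0} = p0" "p0 > 0"
    and p1: "measure M {\<omega> \<in> space M. Z \<omega> = 1} = p1" "p1 > 0"
    and N: "sets N = sets borel"
    and D0: "distributed (uniform_measure M {\<omega> \<in> space M. Z \<omega> = 0}) N X (\<lambda>v. ennreal (f0 v))"
    and D1: "distributed (uniform_measure M {\<omega> \<in> space M. Z \<omega> = 1}) N X (\<lambda>v. ennreal (f1 v))"
    and f0: "\<And>v. f0 v \<ge> 0" and f1: "\<And>v. f1 v \<ge> 0"
    and \<eta>: "\<And>v. \<eta> v = p1 * f1 v / (p0 * f0 v + p1 * f1 v)"
    and \<eta>_meas [measurable]: "\<eta> \<in> borel_measurable borel"
  shows "AE \<omega> in M. posterior M X Z 1 \<omega> = \<eta> (X \<omega>)"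
proof -
  interpret prob_space M by fact
  define F where "F = vimage_algebra (space M) X borel"
  interpret finite_measure_subalgebra M F
    unfolding F_def using M X by (rule finite_measure_subalgebra_vimage)
  let ?E = "\<lambda>k. {\<omega> \<in> space M. Z \<omega> = k}"
  have E [measurable]: "?E k \<in> sets M" for k
    using Z by (rule sets_label)
  have nonneg: "0 \<le> p0 * f0 v" "0 \<le> p1 * f1 v" for v
    using f0 f1 p0(2) p1(2) by simp_all
  \<comment> \<open>Where the mixture density vanishes, the division yields the default value 0; the
    identity survives because both nonnegative summands are then 0.\<close>
  have \<eta>_eq: "p1 * f1 v = \<eta> v * (p0 * f0 v + p1 * f1 v)" for v
    using nonneg[of v] by (cases "p0 * f0 v + p1 * f1 v = 0") (auto simp: \<eta> add_nonneg_eq_0_iff)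
  have \<eta>_bound: "\<bar>\<eta> v\<bar> \<le> 1" for v
    using nonneg[of v] by (auto simp: \<eta> divide_le_eq_1)
  have cls0: "(\<integral>\<omega>. g (X \<omega>) * indicator (?E 0) \<omega> \<partial>M) = p0 * (\<integral>v. f0 v * g v \<partial>N)"
    and cls1: "(\<integral>\<omega>. g (X \<omega>) * indicator (?E 1) \<omega> \<partial>M) = p1 * (\<integral>v. f1 v * g v \<partial>N)"
    if "g \<in> borel_measurable borel" for g :: "'b \<Rightarrow> real"
    using integral_class_density[OF M E _ X N D0 f0 that]
      integral_class_density[OF M E _ X N D1 f1 that] p0 p1 by auto
  have "AE \<omega> in M. real_cond_exp M F (indicator (?E 1)) \<omega> = \<eta> (X \<omega>)"
  proof (rule real_cond_exp_charact)
    show "integrable M (indicator (?E 1) :: _ \<Rightarrow> real)"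
      by (rule integrable_real_indicator[OF E]) (simp add: emeasure_eq_measure)
    show "integrable M (\<lambda>\<omega>. \<eta> (X \<omega>))"
      using \<eta>_bound by (intro integrable_const_bound[where B=1]) auto
    show "(\<lambda>\<omega>. \<eta> (X \<omega>)) \<in> borel_measurable F"
      unfolding F_def by (rule measurable_vimage_algebra_comp) simp
  next
    fix A assume "A \<in> sets F"
    then obtain B where B [measurable]: "B \<in> sets borel" and A: "A = X -` B \<inter> space M"
      unfolding F_def by (auto simp: sets_vimage_algebra2)
    let ?g = "\<lambda>v. indicator B v * \<eta> v"
    have g: "?g \<in> borel_measurable borel"
      by measurable
    have g_bound: "\<bar>?g v\<bar> \<le> 1" for v
      using \<eta>_bound[of v] by (auto simp: indicator_def)
    note int0 = integrable_class_density[OF M E _ X N D0 f0 _ g_bound]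
    note int1 = integrable_class_density[OF M E _ X N D1 f1 _ g_bound]
    have gE: "integrable M (\<lambda>\<omega>. ?g (X \<omega>) * indicator (?E k) \<omega>)" for k
      using \<eta>_bound by (intro integrable_const_bound[where B=1]) (auto simp: indicator_def)
    \<comment> \<open>The two label events partition the space, so the integral splits into one part
      per class.\<close>
    have "(\<integral>\<omega>\<in>A. \<eta> (X \<omega>) \<partial>M) = (\<integral>\<omega>. ?g (X \<omega>) * indicator (?E 0) \<omega> + ?g (X \<omega>) * indicator (?E 1) \<omega> \<partial>M)"
      unfolding set_lebesgue_integral_def A using measurable_space[OF Z]
      by (intro Bochner_Integration.integral_cong) (force simp: indicator_def)+
    also have "\<dots> = p0 * (\<integral>v. f0 v * ?g v \<partial>N) + p1 * (\<integral>v. f1 v * ?g v \<partial>N)"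
      unfolding Bochner_Integration.integral_add[OF gE gE] cls0[OF g] cls1[OF g] ..
    also have "\<dots> = (\<integral>v. p0 * (f0 v * ?g v) + p1 * (f1 v * ?g v) \<partial>N)"
      using int0 int1 p0 p1 by simp
    \<comment> \<open>Multiplying \<eta> by the mixture leaves only the class 1 density, and
      \<open>cls1\<close> then leads back to \<open>M\<close>.\<close>
    also have "\<dots> = (\<integral>v. p1 * (f1 v * indicator B v) \<partial>N)"
    proof (intro Bochner_Integration.integral_cong refl)
      fix v
      show "p0 * (f0 v * ?g v) + p1 * (f1 v * ?g v) = p1 * (f1 v * indicator B v)"
        using \<eta>_eq[of v] by (simp add: indicator_def algebra_simps)
    qed
    also have "\<dots> = (\<integral>\<omega>. indicator B (X \<omega>) * indicator (?E 1) \<omega> \<partial>M)"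
      using cls1[of "indicator B"] by simp
    also have "\<dots> = (\<integral>\<omega>\<in>A. indicator (?E 1) \<omega> \<partial>M)"
      unfolding set_lebesgue_integral_def A
      by (intro Bochner_Integration.integral_cong) (auto simp: indicator_def)
    finally show "(\<integral>\<omega>\<in>A. indicator (?E 1) \<omega> \<partial>M) = (\<integral>\<omega>\<in>A. \<eta> (X \<omega>) \<partial>M)" ..
  qed
  then show ?thesis
    by (simp add: posterior_def F_def)
qed

text \<open>The indicators of the two labels sum to 1 on the space, and conditional expectation is
  linear and fixes constants. This turns the comparison of two posteriors into a threshold at 1/2
  for one of them.\<close>

lemma posterior_complement:
  fixes X :: "'a \<Rightarrow> 'b::topological_space"
  assumes M: "prob_space M"
    and X: "X \<in> borel_measurable M" and Z: "Z \<in> M \<rightarrow>\<^sub>M count_space {0, 1}"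
  shows "AE \<omega> in M. posterior M X Z 0 \<omega> = 1 - posterior M X Z 1 \<omega>"
proof -
  interpret prob_space M by fact
  define F where "F = vimage_algebra (space M) X borel"
  interpret finite_measure_subalgebra M F
    unfolding F_def using M X by (rule finite_measure_subalgebra_vimage)
  let ?I = "\<lambda>k. indicator {\<omega> \<in> space M. Z \<omega> = k} :: 'a \<Rightarrow> real"
  have [measurable]: "{\<omega> \<in> space M. Z \<omega> = k} \<in> sets M" for k
    using Z by (rule sets_label)
  have int: "integrable M (?I k)" for k
    by (rule integrable_real_indicator) (simp_all add: emeasure_eq_measure)
  have "AE \<omega> in M. real_cond_exp M F (?I 0) \<omega> = real_cond_exp M F (\<lambda>\<omega>. 1 - ?I 1 \<omega>) \<omega>"
  proof (rule real_cond_exp_cong)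
    show "AE \<omega> in M. ?I 0 \<omega> = 1 - ?I 1 \<omega>"
      using measurable_space[OF Z] by (intro AE_I2) (force simp: indicator_def)
  qed simp_all
  moreover have "AE \<omega> in M. real_cond_exp M F (\<lambda>\<omega>. 1 - ?I 1 \<omega>) \<omega> =
      real_cond_exp M F (\<lambda>\<omega>. 1) \<omega> - real_cond_exp M F (?I 1) \<omega>"
    using int by (intro real_cond_exp_diff) simp_all
  moreover have "AE \<omega> in M. real_cond_exp M F (\<lambda>\<omega>. 1) \<omega> = 1"
    by (rule real_cond_exp_F_meas) simp_all
  ultimately show ?thesis
    unfolding posterior_def F_def[symmetric] by eventually_elim simp
qed

section \<open>Risk of a classifier and its minimisation\<close>

text \<open>The error indicator is affine in the indicator of label 1, with coefficients that depend
  on \<open>X\<close> alone. Under the integral, that indicator may therefore be replaced by its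
  conditional expectation.\<close>

lemma misclass_prob_eq_integral:
  fixes X :: "'a \<Rightarrow> 'b::topological_space" and \<eta> :: "'b \<Rightarrow> real"
  assumes M: "prob_space M"
    and X [measurable]: "X \<in> borel_measurable M" and Z: "Z \<in> M \<rightarrow>\<^sub>M count_space {0, 1}"
    and \<eta> [measurable]: "\<eta> \<in> borel_measurable borel"
    and \<eta>_int: "integrable M (\<lambda>\<omega>. \<eta> (X \<omega>))"
    and post: "AE \<omega> in M. posterior M X Z 1 \<omega> = \<eta> (X \<omega>)"
    and CL: "CL \<in> borel \<rightarrow>\<^sub>M count_space {0, 1}"
  shows "integrable M (\<lambda>\<omega>. if CL (X \<omega>) = 0 then \<eta> (X \<omega>) else 1 - \<eta> (X \<omega>))"
    and "misclass_prob M X Z CL = (\<integral>\<omega>. (if CL (X \<omega>) = 0 then \<eta> (X \<omega>) else 1 - \<eta> (X \<omega>)) \<partial>M)"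
proof -
  interpret prob_space M by fact
  define F where "F = vimage_algebra (space M) X borel"
  interpret finite_measure_subalgebra M F
    unfolding F_def using M X by (rule finite_measure_subalgebra_vimage)
  let ?I = "indicator {\<omega> \<in> space M. Z \<omega> = 1} :: 'a \<Rightarrow> real"
  have [measurable]: "{\<omega> \<in> space M. Z \<omega> = k} \<in> sets M" for k
    using Z by (rule sets_label)
  \<comment> \<open>A classifier is itself a label on the Borel space, so the lemma on label events
    applies to it.\<close>
  have [measurable]: "{v. CL v = 0} \<in> sets borel"
    using sets_label[OF CL, of 0] by simp
  \<comment> \<open>Predicting 0 errs exactly on label 1, so there \<open>u = 0\<close> and
    \<open>w = 1\<close>; predicting 1 errs exactly off label 1, so there \<open>u = 1\<close> and
    \<open>w = -1\<close>.\<close>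
  define w u :: "'b \<Rightarrow> real" where "w v = 2 * indicator {v. CL v = 0} v - 1"
    and "u v = 1 - indicator {v. CL v = 0} v" for v
  have [measurable]: "w \<in> borel_measurable borel" "u \<in> borel_measurable borel"
    unfolding w_def u_def by measurable
  have wI: "integrable M (\<lambda>\<omega>. w (X \<omega>) * ?I \<omega>)"
  proof (rule integrable_const_bound)
    show "AE \<omega> in M. norm (w (X \<omega>) * ?I \<omega>) \<le> 1"
      by (auto simp: w_def indicator_def)
  qed measurable
  have w\<eta>: "integrable M (\<lambda>\<omega>. w (X \<omega>) * \<eta> (X \<omega>))"
  proof (rule Bochner_Integration.integrable_bound[OF \<eta>_int])
    show "AE \<omega> in M. norm (w (X \<omega>) * \<eta> (X \<omega>)) \<le> norm (\<eta> (X \<omega>))"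
      by (auto simp: w_def indicator_def)
  qed measurable
  have u: "integrable M (\<lambda>\<omega>. u (X \<omega>))"
  proof (rule integrable_const_bound)
    show "AE \<omega> in M. norm (u (X \<omega>)) \<le> 1"
      by (auto simp: u_def indicator_def)
  qed measurable
  have eq: "(if CL (X \<omega>) = 0 then \<eta> (X \<omega>) else 1 - \<eta> (X \<omega>)) = u (X \<omega>) + w (X \<omega>) * \<eta> (X \<omega>)" for \<omega>
    by (simp add: u_def w_def)
  show "integrable M (\<lambda>\<omega>. if CL (X \<omega>) = 0 then \<eta> (X \<omega>) else 1 - \<eta> (X \<omega>))"
    unfolding eq using u w\<eta> by simp
  \<comment> \<open>The factor \<open>w (X \<omega>)\<close> is measurable with respect to
    \<open>F\<close>, so conditioning acts on the indicator only.\<close>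
  have "(\<integral>\<omega>. w (X \<omega>) * ?I \<omega> \<partial>M) = (\<integral>\<omega>. w (X \<omega>) * real_cond_exp M F ?I \<omega> \<partial>M)"
    using wI by (intro real_cond_exp_intg(2)[symmetric])
      (simp_all add: F_def measurable_vimage_algebra_comp)
  also have "\<dots> = (\<integral>\<omega>. w (X \<omega>) * \<eta> (X \<omega>) \<partial>M)"
    using post by (intro integral_cong_AE) (auto simp: posterior_def F_def)
  finally have wI_eq: "(\<integral>\<omega>. w (X \<omega>) * ?I \<omega> \<partial>M) = (\<integral>\<omega>. w (X \<omega>) * \<eta> (X \<omega>) \<partial>M)" .
  have CL01: "CL v \<in> {0, 1}" for v
    using measurable_space[OF CL, of v] by simp
  have "misclass_prob M X Z CL = (\<integral>\<omega>. indicator {\<omega> \<in> space M. CL (X \<omega>) \<noteq> Z \<omega>} \<omega> \<partial>M)"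
    by (simp add: misclass_prob_def Int_def conj_commute)
  also have "\<dots> = (\<integral>\<omega>. u (X \<omega>) + w (X \<omega>) * ?I \<omega> \<partial>M)"
  proof (intro Bochner_Integration.integral_cong refl)
    fix \<omega> assume "\<omega> \<in> space M"
    then show "indicator {\<omega> \<in> space M. CL (X \<omega>) \<noteq> Z \<omega>} \<omega> = u (X \<omega>) + w (X \<omega>) * ?I \<omega>"
      using measurable_space[OF Z, of \<omega>] CL01[of "X \<omega>"] by (auto simp: u_def w_def)
  qed
  also have "\<dots> = (\<integral>\<omega>. u (X \<omega>) + w (X \<omega>) * \<eta> (X \<omega>) \<partial>M)"
    using u wI w\<eta> wI_eq by simp
  finally show "misclass_prob M X Z CL =
      (\<integral>\<omega>. (if CL (X \<omega>) = 0 then \<eta> (X \<omega>) else 1 - \<eta> (X \<omega>)) \<partial>M)"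
    unfolding eq .
qed

text \<open>Thresholding at 1/2 attains the smaller of \<eta> and \<open>1 - \<eta>\<close> at every
  point, hence the least risk. Uniqueness is read off from the tie rule in
  \<open>bayes_classifier\<close>, since minimality leaves the label free where \<eta> is
  1/2.\<close>

lemma bayes_classifier_threshold:
  fixes X :: "'a \<Rightarrow> 'b::topological_space" and \<eta> :: "'b \<Rightarrow> real"
  assumes M: "prob_space M"
    and X: "X \<in> borel_measurable M" and Z: "Z \<in> M \<rightarrow>\<^sub>M count_space {0, 1}"
    and \<eta> [measurable]: "\<eta> \<in> borel_measurable borel"
    and \<eta>_int: "integrable M (\<lambda>\<omega>. \<eta> (X \<omega>))"
    and post: "AE \<omega> in M. posterior M X Z 1 \<omega> = \<eta> (X \<omega>)"
    and CL: "\<And>v. CL v = (if \<eta> v \<ge> 1/2 then 1 else 0)"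
  shows "bayes_classifier M X Z CL"
    and "bayes_classifier M X Z CL' \<Longrightarrow> AE \<omega> in M. CL' (X \<omega>) = CL (X \<omega>)"
proof -
  have "(\<lambda>v. if \<eta> v \<ge> 1/2 then 1 else 0 :: nat) \<in> borel \<rightarrow>\<^sub>M count_space {0, 1}"
    by measurable
  then have CL_meas: "CL \<in> borel \<rightarrow>\<^sub>M count_space {0, 1}"
    using CL by (simp cong: measurable_cong)
  note risk = misclass_prob_eq_integral[OF M X Z \<eta> \<eta>_int post]
  have "misclass_prob M X Z CL \<le> misclass_prob M X Z D"
    if D: "D \<in> borel \<rightarrow>\<^sub>M count_space {0, 1}" for D
    unfolding risk(2)[OF CL_meas] risk(2)[OF D]
    by (intro integral_mono risk(1) CL_meas D) (auto simp: CL)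
  moreover have rule:
    "AE \<omega> in M. CL (X \<omega>) = (if posterior M X Z 1 \<omega> \<ge> posterior M X Z 0 \<omega> then 1 else 0)"
    using post posterior_complement[OF M X Z] by eventually_elim (auto simp: CL)
  ultimately show "bayes_classifier M X Z CL"
    using CL_meas by (simp add: bayes_classifier_def)
  show "AE \<omega> in M. CL' (X \<omega>) = CL (X \<omega>)" if "bayes_classifier M X Z CL'"
  proof -
    have "AE \<omega> in M. CL' (X \<omega>) = (if posterior M X Z 1 \<omega> \<ge> posterior M X Z 0 \<omega> then 1 else 0)"
      using that by (simp add: bayes_classifier_def)
    with rule show ?thesis
      by eventually_elim simp
  qed
qed

section \<open>Gaussian densities with isotropic covariance\<close>

lemma mat_mult_vector: "mat s *v v = s *\<^sub>R v" for v :: "real ^ 'n"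
  by (simp add: mat_def matrix_vector_mult_def vec_eq_iff if_distrib if_distribR cong: if_cong)

lemma matrix_inv_mat:
  assumes "s \<noteq> 0"
  shows "matrix_inv (mat s :: real ^ 'n ^ 'n) = mat (1 / s)"
proof -
  have "mat s ** mat t = (mat (s * t) :: real ^ 'n ^ 'n)" for s t :: real
    by (simp add: matrix_eq mat_mult_vector flip: matrix_vector_mul_assoc)
  then have "mat s ** mat (1 / s) = (mat 1 :: real ^ 'n ^ 'n)"
    and "mat (1 / s) ** mat s = (mat 1 :: real ^ 'n ^ 'n)"
    using assms by simp_all
  then show ?thesis
    unfolding matrix_inv_def
    \<comment> \<open>\<open>matrix_inv\<close> is a Hilbert choice, so uniqueness of the two-sided
      inverse is needed besides the product identities.\<close>
    by (intro some_equality) (auto, metis matrix_mul_assoc matrix_mul_rid)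
qed

lemma det_mat: "det (mat s :: real ^ 'n ^ 'n) = s ^ CARD('n)"
  by (subst det_diagonal) (simp_all add: mat_def)

lemma mvnormal_density_isotropic:
  fixes m v :: "real ^ 'n"
  assumes "\<sigma> > 0"
  shows "mvnormal_density m (mat (\<sigma>\<^sup>2)) v =
    exp (- ((v - m) \<bullet> (v - m)) / (2 * \<sigma>\<^sup>2)) / (sqrt ((2 * pi) ^ CARD('n)) * \<sigma> ^ CARD('n))"
proof -
  have "sqrt ((\<sigma>\<^sup>2) ^ CARD('n)) = \<sigma> ^ CARD('n)"
    using assms by (simp add: real_sqrt_power)
  moreover have "(v - m) \<bullet> (matrix_inv (mat (\<sigma>\<^sup>2)) *v (v - m)) = ((v - m) \<bullet> (v - m)) / \<sigma>\<^sup>2"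
    using assms by (simp add: matrix_inv_mat mat_mult_vector)
  ultimately show ?thesis
    by (simp add: mvnormal_density_def det_mat real_sqrt_mult mult.commute)
qed

text \<open>The powers of \<open>2 * pi\<close> cancel in the quotient of the densities, the ratio
  of the powers of the deviations becomes the logarithm in \<open>c\<close>, and expanding the
  squared distances gives the other terms.\<close>

lemma mvnormal_density_quotient:
  fixes \<mu>0 \<mu>1 b v :: "real ^ 'n" and \<sigma>0 \<sigma>1 a c :: real
  assumes "\<sigma>0 > 0" and "\<sigma>1 > 0"
    and a: "a = 1/2 * (1 / \<sigma>1\<^sup>2 - 1 / \<sigma>0\<^sup>2)"
    and b: "b = \<mu>0 /\<^sub>R \<sigma>0\<^sup>2 - \<mu>1 /\<^sub>R \<sigma>1\<^sup>2"
    and c: "c = (\<mu>1 \<bullet> \<mu>1) / (2 * \<sigma>1\<^sup>2) - (\<mu>0 \<bullet> \<mu>0) / (2 * \<sigma>0\<^sup>2)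
             + ln (\<sigma>1 ^ CARD('n) / \<sigma>0 ^ CARD('n))"
  shows "mvnormal_density \<mu>0 (mat (\<sigma>0\<^sup>2)) v =
    exp (a * (v \<bullet> v) + b \<bullet> v + c) * mvnormal_density \<mu>1 (mat (\<sigma>1\<^sup>2)) v"
proof -
  let ?q = "\<lambda>\<mu> \<sigma>. - ((v - \<mu>) \<bullet> (v - \<mu>)) / (2 * \<sigma>\<^sup>2)"
  have "a * (v \<bullet> v) + b \<bullet> v + c = ?q \<mu>0 \<sigma>0 - ?q \<mu>1 \<sigma>1 + ln (\<sigma>1 ^ CARD('n) / \<sigma>0 ^ CARD('n))"
  proof -
    \<comment> \<open>With the inverse variances as variables, the claim is a polynomial identity in
      \<open>s\<close>, \<open>t\<close> and the inner products, plus the same logarithm on both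
      sides.\<close>
    define s t where "s = inverse (\<sigma>0\<^sup>2)" and "t = inverse (\<sigma>1\<^sup>2)"
    have div: "x / (2 * \<sigma>0\<^sup>2) = x * s / 2" "x / (2 * \<sigma>1\<^sup>2) = x * t / 2" for x
      by (simp_all add: s_def t_def inverse_eq_divide)
    have q: "(v - \<mu>) \<bullet> (v - \<mu>) = v \<bullet> v - 2 * (\<mu> \<bullet> v) + \<mu> \<bullet> \<mu>" for \<mu>
      by (simp add: inner_diff_left inner_diff_right inner_commute)
    have a': "a = (t - s) / 2" and b': "b \<bullet> v = s * (\<mu>0 \<bullet> v) - t * (\<mu>1 \<bullet> v)"
      by (simp_all add: a b s_def t_def inverse_eq_divide inner_diff_left)
    show ?thesis
      unfolding a' b' c div q by (simp add: field_simps)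
  qed
  then have "exp (a * (v \<bullet> v) + b \<bullet> v + c) =
      exp (?q \<mu>0 \<sigma>0) / exp (?q \<mu>1 \<sigma>1) * (\<sigma>1 ^ CARD('n) / \<sigma>0 ^ CARD('n))"
    using assms(1,2) by (simp only: exp_add exp_diff) simp
  then show ?thesis
    using assms(1,2) by (simp add: mvnormal_density_isotropic)
qed

section \<open>The Bayes classifier for two equally likely isotropic Gaussian classes\<close>

theorem theorem1:
  fixes M :: "'a measure"
    and X :: "'a \<Rightarrow> real ^ 'n" and Z :: "'a \<Rightarrow> nat"
    and \<mu>0 \<mu>1 b :: "real ^ 'n" and \<sigma>0 \<sigma>1 a c :: real
    and Q \<eta> :: "real ^ 'n \<Rightarrow> real" and CL :: "real ^ 'n \<Rightarrow> nat"
  assumes "prob_space M"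
    and "\<sigma>0 > 0" and "\<sigma>1 > 0" and "\<sigma>0\<^sup>2 \<noteq> \<sigma>1\<^sup>2"
    and "X \<in> borel_measurable M" and "Z \<in> M \<rightarrow>\<^sub>M count_space {0, 1}"
    and "measure M {\<omega> \<in> space M. Z \<omega> = 0} = 1/2"
    and "measure M {\<omega> \<in> space M. Z \<omega> = 1} = 1/2"
    and "distributed (uniform_measure M {\<omega> \<in> space M. Z \<omega> = 0}) lborel X
           (\<lambda>v. ennreal (mvnormal_density \<mu>0 (mat (\<sigma>0\<^sup>2)) v))"
    and "distributed (uniform_measure M {\<omega> \<in> space M. Z \<omega> = 1}) lborel X
           (\<lambda>v. ennreal (mvnormal_density \<mu>1 (mat (\<sigma>1\<^sup>2)) v))"
    and "a = 1/2 * (1 / \<sigma>1\<^sup>2 - 1 / \<sigma>0\<^sup>2)"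
    and "b = \<mu>0 /\<^sub>R \<sigma>0\<^sup>2 - \<mu>1 /\<^sub>R \<sigma>1\<^sup>2"
    and "c = (\<mu>1 \<bullet> \<mu>1) / (2 * \<sigma>1\<^sup>2) - (\<mu>0 \<bullet> \<mu>0) / (2 * \<sigma>0\<^sup>2)
             + ln (\<sigma>1 ^ CARD('n) / \<sigma>0 ^ CARD('n))"
    and "\<And>v. Q v = a * (v \<bullet> v) + b \<bullet> v + c"
    and "\<And>v. \<eta> v = 1 / (1 + exp (Q v))"
    and "\<And>v. CL v = (if \<eta> v \<ge> 1/2 then 1 else 0)"
  shows "(AE \<omega> in M. posterior M X Z 1 \<omega> = \<eta> (X \<omega>)) \<and>
         bayes_classifier M X Z CL \<and>
         (\<forall>CL'. bayes_classifier M X Z CL' \<longrightarrow> (AE \<omega> in M. CL' (X \<omega>) = CL (X \<omega>)))"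
proof -
  note M = assms(1) and X = assms(5) and Z = assms(6)
  let ?f0 = "mvnormal_density \<mu>0 (mat (\<sigma>0\<^sup>2))" and ?f1 = "mvnormal_density \<mu>1 (mat (\<sigma>1\<^sup>2))"
  interpret prob_space M by fact
  have f1_pos: "?f1 v > 0" for v
    using assms(3) by (simp add: mvnormal_density_isotropic)
  have f0: "?f0 v = exp (Q v) * ?f1 v" for v
    unfolding assms(14) by (rule mvnormal_density_quotient[OF assms(2,3,11-13)])
  \<comment> \<open>The equal priors and the positive factor \<open>?f1 v\<close> cancel from the
    Bayes quotient, leaving the logistic form.\<close>
  have \<eta>_eq: "\<eta> v = 1/2 * ?f1 v / (1/2 * ?f0 v + 1/2 * ?f1 v)" for v
  proof -
    have "1/2 * ?f0 v + 1/2 * ?f1 v = (1 + exp (Q v)) * (1/2 * ?f1 v)"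
      unfolding f0 by (simp add: algebra_simps)
    then show ?thesis
      using f1_pos[of v] by (simp add: assms(15))
  qed
  have \<eta> [measurable]: "\<eta> \<in> borel_measurable borel"
    unfolding assms(14,15)[abs_def] by measurable
  have "\<bar>\<eta> v\<bar> \<le> 1" for v
    by (simp add: assms(15) add_pos_pos)
  then have \<eta>_int: "integrable M (\<lambda>\<omega>. \<eta> (X \<omega>))"
    using X by (intro integrable_const_bound[where B=1]) auto
  have post: "AE \<omega> in M. posterior M X Z 1 \<omega> = \<eta> (X \<omega>)"
  proof (rule posterior_eq_density_ratio[OF M X Z assms(7) _ assms(8) _ _ assms(9,10) _ _ \<eta>_eq \<eta>])
    show "?f0 v \<ge> 0" "?f1 v \<ge> 0" for v
      using f1_pos[of v] by (simp_all add: f0)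
  qed simp_all
  show ?thesis
    using post bayes_classifier_threshold[OF M X Z \<eta> \<eta>_int post assms(16)] by blast
qed

end
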